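(* Let $g\ge4$ be even and let $q>g-1$ be an integer relatively prime to $g-1$. Let $m=\frac{g^q-1}{g-1}$. Then $m$ is incomplete and $o_g(m)=q$; moreover every divisor $e>1$ of $m$ satisfies $o_g(e)\neq1$ and $o_g(e)\mid q$. If, in addition, $q$ is prime, then there exist primitive numbers of order $q$, and every primitive number $d$ dividing $m$ satisfies $o_g(d)=q$.
   Context: For an odd integer $m\ge1$, an extreme cycle for the digit set $\{0,m\}$ (with respect to the even integer $g\ge4$) is a finite set of distinct integers $\{x_0,\dots,x_{r-1}\}$ together with digits $l_0,\dots,l_{r-1}\in\{0,m\}$ such that $x_{j+1}=(x_j+l_j)/g$ for $0\le j\le r-2$ and $x_0=(x_{r-1}+l_{r-1})/g$. The cycle $\{0\}$ is the trivial extreme cycle. $m$ is complete if the only extreme cycle for $\{0,m\}$ is the trivial one, and incomplete otherwise. An odd number $m$ is primitive if it is incomplete and every proper divisor of $m$ is complete. For $m$ coprime to $g$, $o_g(m)$ (the order of $m$) denotes the order of $g$ in $U(\mathbb{Z}_m)$. *)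

theory Defs
  imports Complex_Main "HOL-Number_Theory.Number_Theory"
begin

text \<open>The cycle is represented by its underlying set of integers; the enumeration \<open>x\<close> and the
  digits \<open>l\<close> are existential witnesses, and only their values at indices below \<open>r\<close> matter.
  The quotient by \<open>g\<close> is taken in the reals, so the equations say in particular that it is
  an integer.\<close>

definition extreme_cycle :: "nat \<Rightarrow> nat \<Rightarrow> int set \<Rightarrow> bool" where
  "extreme_cycle g m X \<longleftrightarrow>
     (\<exists>r (x :: nat \<Rightarrow> int) (l :: nat \<Rightarrow> int).
        r \<ge> 1 \<and> inj_on x {..<r} \<and> X = x ` {..<r} \<and>
        (\<forall>j<r. l j \<in> {0, int m}) \<and>
        (\<forall>j. j + 1 < r \<longrightarrow> real_of_int (x (j + 1)) = real_of_int (x j + l j) / real g) \<and>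
        real_of_int (x 0) = real_of_int (x (r - 1) + l (r - 1)) / real g)"

definition complete_number :: "nat \<Rightarrow> nat \<Rightarrow> bool" where
  "complete_number g m \<longleftrightarrow> {X. extreme_cycle g m X} = {{0}}"

text \<open>Completeness and incompleteness are meant for odd \<open>m\<close> only.\<close>

definition incomplete_number :: "nat \<Rightarrow> nat \<Rightarrow> bool" where
  "incomplete_number g m \<longleftrightarrow> \<not> complete_number g m"

definition primitive_number :: "nat \<Rightarrow> nat \<Rightarrow> bool" where
  "primitive_number g m \<longleftrightarrow>
     odd m \<and> incomplete_number g m \<and> (\<forall>d. d dvd m \<and> d \<noteq> m \<longrightarrow> complete_number g d)"

end

theory Submission
  imports Defs
begin

text \<open>The map \<open>x \<mapsto> (x + l) / g\<close>, with \<open>l\<close> equal to 0 or \<open>m\<close> as needed, acts on the points \<open>(\<Sum>i\<in>B. g ^ i) / (g - 1)\<close>, where \<open>B\<close> is a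
  \<open>(g - 1)\<close>-element subset of \<open>{..<q}\<close>, by rotating \<open>B\<close> cyclically; these points are integers
  because \<open>g ^ i\<close> is congruent to 1 modulo \<open>g - 1\<close>. So they form a finite set of nonzero integers
  closed under the dynamics, and it contains an extreme cycle. For the orders: if \<open>g\<close> is congruent
  to 1 modulo a divisor \<open>e\<close> of \<open>m\<close>, then \<open>m\<close> is congruent to \<open>q\<close> modulo \<open>e\<close>, so \<open>e\<close> divides both
  \<open>q\<close> and \<open>g - 1\<close>. For prime \<open>q\<close> a minimal incomplete divisor of \<open>m\<close> is primitive.\<close>

text \<open>Used to bound a cycle through the predecessors of its maximum and minimum.\<close>

lemma extreme_cycle_predecessor:
  assumes "extreme_cycle g m X" "g > 0" "y \<in> X"
  obtains x l where "x \<in> X" "l \<in> {0, int m}" "int g * y = x + l"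
proof -
  from assms(1) obtain r and x l :: "nat \<Rightarrow> int" where r: "r \<ge> 1" and X: "X = x ` {..<r}"
    and l: "\<forall>j<r. l j \<in> {0, int m}"
    and step: "\<forall>j. j + 1 < r \<longrightarrow> real_of_int (x (j + 1)) = real_of_int (x j + l j) / real g"
    and last: "real_of_int (x 0) = real_of_int (x (r - 1) + l (r - 1)) / real g"
    unfolding extreme_cycle_def by blast
  have "\<exists>k<r. real_of_int y = real_of_int (x k + l k) / real g"
  proof -
    obtain j where j: "j < r" "y = x j" using assms(3) X by auto
    show ?thesis
    proof (cases j)
      case 0
      then show ?thesis using last j r by (intro exI[of _ "r - 1"]) auto
    next
      case (Suc i)
      then show ?thesis using step j by (intro exI[of _ i]) auto
    qed
  qed
  then obtain k where k: "k < r" "real_of_int y = real_of_int (x k + l k) / real g" by blast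
  then have "real_of_int (int g * y) = real_of_int (x k + l k)"
    using assms(2) by (simp add: field_simps)
  then have "int g * y = x k + l k" by linarith
  with that k(1) l X show thesis by blast
qed

lemma extreme_cycle_nonempty: "extreme_cycle g m X \<Longrightarrow> X \<noteq> {} \<and> finite X"
  unfolding extreme_cycle_def by (auto simp: lessThan_empty_iff)

text \<open>Choosing one successor for each point gives a self-map of \<open>A\<close>. As
  \<open>A\<close> is finite, the orbit of any point becomes periodic, and its periodic part is an
  extreme cycle.\<close>

lemma exists_extreme_cycle_subset:
  assumes "g > 0" "finite A" "A \<noteq> {}"
    and closed: "\<And>x. x \<in> A \<Longrightarrow> \<exists>y\<in>A. \<exists>l\<in>{0, int m}. int g * y = x + l"
  obtains X where "extreme_cycle g m X" "X \<subseteq> A"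
proof -
  obtain f where f: "\<And>x. x \<in> A \<Longrightarrow> f x \<in> A \<and> int g * f x - x \<in> {0, int m}"
  proof -
    have "\<forall>x\<in>A. \<exists>y. y \<in> A \<and> int g * y - x \<in> {0, int m}"
    proof
      fix x assume "x \<in> A"
      from closed[OF this] obtain y l where "y \<in> A" "l \<in> {0, int m}" "int g * y = x + l" by blast
      then show "\<exists>y. y \<in> A \<and> int g * y - x \<in> {0, int m}" by (intro exI[of _ y]) auto
    qed
    then show thesis using that by metis
  qed
  obtain a where a: "a \<in> A" using assms(3) by blast
  have orbit: "(f ^^ n) x \<in> A" if "x \<in> A" for n x
    using that f by (induction n) auto
  have "\<not> inj (\<lambda>n. (f ^^ n) a)"
  proof
    assume "inj (\<lambda>n. (f ^^ n) a)"
    moreover have "range (\<lambda>n. (f ^^ n) a) \<subseteq> A" using orbit a by auto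
    ultimately show False
      using assms(2) finite_subset finite_imageD infinite_UNIV_nat by blast
  qed
  then obtain i j where ij: "i < j" "(f ^^ i) a = (f ^^ j) a"
    unfolding inj_on_def by (metis linorder_neqE_nat)
  \<comment> \<open>The repetition in the orbit of \<open>a\<close> makes \<open>z\<close> a
    periodic point; \<open>a\<close> itself need not be one.\<close>
  define z where "z = (f ^^ i) a"
  have z: "z \<in> A" using orbit a by (simp add: z_def)
  define P where "P = (\<lambda>n. 0 < n \<and> (f ^^ n) z = z)"
  have "(f ^^ (j - i)) z = (f ^^ (j - i + i)) a" by (simp only: z_def funpow_add comp_apply)
  then have "P (j - i)" using ij by (simp add: P_def z_def)
  \<comment> \<open>Taking the least period is what makes the points \<open>x 0\<close>, ...,
    \<open>x (r - 1)\<close> distinct.\<close>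
  define r where "r = (LEAST n. P n)"
  have r: "0 < r" "(f ^^ r) z = z"
    using LeastI[of P, OF \<open>P (j - i)\<close>] by (auto simp: r_def P_def)
  have least: "(f ^^ n) z \<noteq> z" if "0 < n" "n < r" for n
    using not_less_Least[of n P] that by (auto simp: r_def P_def)
  define x where "x = (\<lambda>n. (f ^^ n) z)"
  define l where "l = (\<lambda>n. int g * f (x n) - x n)"
  have xA: "x n \<in> A" for n using orbit z by (simp add: x_def)
  have step: "real_of_int (x (Suc n)) = real_of_int (x n + l n) / real g" for n
    using assms(1) by (simp add: x_def l_def)
  have "extreme_cycle g m (x ` {..<r})"
    unfolding extreme_cycle_def
  proof (rule exI[of _ r], rule exI[of _ x], rule exI[of _ l], intro conjI allI impI)
    show "inj_on x {..<r}"
      using inj_on_funpow_least[of r f z] r least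
      by (simp add: x_def lessThan_atLeast0)
    show "real_of_int (x 0) = real_of_int (x (r - 1) + l (r - 1)) / real g"
    proof -
      have "x 0 = x (Suc (r - 1))" using r by (simp add: x_def)
      then show ?thesis using step[of "r - 1"] by simp
    qed
  qed (use r step f xA in \<open>auto simp: l_def\<close>)
  moreover have "x ` {..<r} \<subseteq> A" using xA by auto
  ultimately show thesis using that by blast
qed

lemma extreme_cycle_trivial: "extreme_cycle g m {0}"
  unfolding extreme_cycle_def
  by (intro exI[of _ 1] exI[of _ "\<lambda>_. 0"]) (auto simp: inj_on_def)

text \<open>The predecessors of the extremal points give \<open>(g - 1) * Max X \<le> 1\<close> and
  \<open>(g - 1) * Min X \<ge> 0\<close>, and \<open>g - 1 \<ge> 2\<close> then forces both to be 0.
  For \<open>g = 2\<close> the fixed point 1 = (1 + 1) / 2 would be a second cycle.\<close>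

lemma complete_number_1:
  assumes "g \<ge> 3"
  shows "complete_number g 1"
proof -
  have "X = {0}" if X: "extreme_cycle g 1 X" for X
  proof -
    have fin: "X \<noteq> {}" "finite X" using extreme_cycle_nonempty[OF X] by auto
    obtain u k where u: "u \<in> X" "k \<in> {0, 1}" "int g * Max X = u + k"
      using extreme_cycle_predecessor[OF X, of "Max X"] assms fin by auto
    obtain v n where v: "v \<in> X" "n \<in> {0, 1}" "int g * Min X = v + n"
      using extreme_cycle_predecessor[OF X, of "Min X"] assms fin by auto
    have "(int g - 1) * Max X \<le> 1" using u(2,3) Max_ge[OF fin(2) u(1)] by (auto simp: algebra_simps)
    then have "Max X \<le> 0"
      using assms mult_mono[of 2 "int g - 1" 1 "Max X"] by (cases "Max X \<le> 0") auto
    moreover have "0 \<le> (int g - 1) * Min X" using v(2,3) Min_le[OF fin(2) v(1)] by (auto simp: algebra_simps)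
    then have "0 \<le> Min X" using assms by (auto simp: zero_le_mult_iff)
    ultimately have "x = 0" if "x \<in> X" for x
      using that fin Max_ge[of X x] Min_le[of X x] by linarith
    then show "X = {0}" using fin by blast
  qed
  then show ?thesis unfolding complete_number_def using extreme_cycle_trivial by auto
qed

text \<open>Division by \<open>g\<close> lowers every exponent by one. Only the exponent 0 obstructs
  this; adding \<open>g ^ q - 1\<close> trades it for the exponent \<open>q\<close>, which becomes
  \<open>q - 1\<close>. So \<open>k = 1\<close> exactly when 0 lies in \<open>B\<close>.\<close>

lemma cyclic_rotation:
  fixes g :: int
  assumes "B \<subseteq> {..<q}"
  obtains C k where "C \<subseteq> {..<q}" "card C = card B" "k \<in> {0, 1}"
    "(\<Sum>i\<in>B. g ^ i) + k * (g ^ q - 1) = g * (\<Sum>i\<in>C. g ^ i)"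
proof (cases "0 \<in> B")
  case True
  define B' where "B' = B - {0}"
  define C where "C = insert (q - 1) ((\<lambda>i. i - 1) ` B')"
  have fin: "finite B" using assms finite_subset by blast
  have q: "q > 0" using True assms by auto
  \<comment> \<open>Truncated subtraction sends 0 and 1 both to 0, so 0 has to be removed
    first.\<close>
  have inj: "inj_on (\<lambda>i. i - 1) B'" by (auto simp: inj_on_def B'_def)
  have new: "q - 1 \<notin> (\<lambda>i. i - 1) ` B'" using assms by (force simp: B'_def)
  have "card C = card B"
    using fin new card_Suc_Diff1[OF fin True] card_image[OF inj]
    unfolding C_def by (subst card_insert_disjoint) (simp_all add: B'_def)
  moreover have "C \<subseteq> {..<q}" using assms q by (auto simp: C_def B'_def)
  moreover have "(\<Sum>i\<in>B. g ^ i) + 1 * (g ^ q - 1) = g * (\<Sum>i\<in>C. g ^ i)"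
  proof -
    have "(\<Sum>i\<in>B. g ^ i) = 1 + (\<Sum>i\<in>B'. g ^ i)"
      using sum.remove[OF fin True, of "\<lambda>i. g ^ i"] by (simp add: B'_def)
    also have "(\<Sum>i\<in>B'. g ^ i) = (\<Sum>i\<in>B'. g * g ^ (i - 1))"
      by (intro sum.cong) (auto simp: B'_def simp flip: power_Suc)
    also have "\<dots> = g * (\<Sum>i\<in>(\<lambda>i. i - 1) ` B'. g ^ i)"
      by (simp only: sum.reindex[OF inj] sum_distrib_left comp_def)
    finally have "(\<Sum>i\<in>B. g ^ i) = 1 + g * (\<Sum>i\<in>(\<lambda>i. i - 1) ` B'. g ^ i)" .
    moreover have "finite ((\<lambda>i. i - 1) ` B')" using fin by (simp add: B'_def)
    moreover have "g * g ^ (q - 1) = g ^ q" using q by (simp flip: power_Suc)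
    ultimately show ?thesis unfolding C_def using new by (simp add: distrib_left)
  qed
  ultimately show thesis using that[of C 1] by simp
next
  case False
  define C where "C = (\<lambda>i. i - 1) ` B"
  have pos: "i > 0" if "i \<in> B" for i using False that by (cases i) auto
  have inj: "inj_on (\<lambda>i. i - 1) B"
    by (rule inj_onI) (metis pos Suc_pred')
  have "card C = card B" unfolding C_def by (rule card_image[OF inj])
  moreover have "C \<subseteq> {..<q}" using assms by (auto simp: C_def)
  moreover have "(\<Sum>i\<in>B. g ^ i) = g * (\<Sum>i\<in>C. g ^ i)"
    unfolding C_def sum.reindex[OF inj] sum_distrib_left
    by (intro sum.cong) (auto simp: pos simp flip: power_Suc)
  ultimately show thesis using that[of C 0] by simp
qed

lemma dvd_sum_powers_diff_card:
  fixes g :: int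
  shows "g - 1 dvd (\<Sum>i\<in>B. g ^ i) - int (card B)"
proof -
  have "(\<Sum>i\<in>B. g ^ i) - int (card B) = (\<Sum>i\<in>B. g ^ i - 1)"
    by (simp add: sum_subtractf)
  also have "g - 1 dvd \<dots>"
    by (intro dvd_sum) (simp add: power_diff_1_eq)
  finally show ?thesis .
qed

lemma incomplete_repunit:
  fixes g q m :: nat
  assumes g: "g \<ge> 2" and q: "q \<ge> g - 1" and m: "(g - 1) * m = g ^ q - 1"
  shows "incomplete_number g m"
proof -
  define S where "S = (\<lambda>B. \<Sum>i\<in>B. int g ^ i)"
  define \<B> where "\<B> = {B. B \<subseteq> {..<q} \<and> card B = g - 1}"
  define A where "A = (\<lambda>B. S B div (int g - 1)) ` \<B>"
  have m': "(int g - 1) * int m = int g ^ q - 1"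
    using arg_cong[OF m, of int] g by (simp add: of_nat_diff)
  have S: "(int g - 1) * (S B div (int g - 1)) = S B" if "B \<in> \<B>" for B
  proof (rule dvd_mult_div_cancel)
    have "int (card B) = int g - 1" using that g by (simp add: \<B>_def)
    then show "int g - 1 dvd S B"
      using dvd_sum_powers_diff_card[of "int g" B] unfolding S_def
      by (metis dvd_diffD1 dvd_refl diff_add_cancel dvd_add)
  qed
  \<comment> \<open>This keeps the cycle found in \<open>A\<close> from being the trivial
    one.\<close>
  have "0 \<notin> A"
  proof
    assume "0 \<in> A"
    then obtain B where B: "B \<in> \<B>" "S B = 0" unfolding A_def using S by force
    have "B \<noteq> {}" "finite B" using B(1) g finite_subset by (auto simp: \<B>_def)
    then have "S B > 0" unfolding S_def using g by (intro sum_pos) auto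
    with B(2) show False by simp
  qed
  have "finite A" by (simp add: A_def \<B>_def)
  \<comment> \<open>The bound on \<open>q\<close> leaves room for \<open>g - 1\<close> distinct
    exponents.\<close>
  moreover have "{..<g - 1} \<in> \<B>" using q by (auto simp: \<B>_def)
  then have "A \<noteq> {}" by (auto simp: A_def)
  moreover have "\<exists>y\<in>A. \<exists>l\<in>{0, int m}. int g * y = x + l" if x: "x \<in> A" for x
  proof -
    obtain B where B: "B \<in> \<B>" "x = S B div (int g - 1)" using x by (auto simp: A_def)
    obtain C k where C: "C \<subseteq> {..<q}" "card C = card B" "k \<in> {0, 1}"
      "S B + k * (int g ^ q - 1) = int g * S C"
      using cyclic_rotation[of B q "int g"] B(1) unfolding S_def \<B>_def by blast
    define y where "y = S C div (int g - 1)"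
    have CB: "C \<in> \<B>" using B(1) C by (simp add: \<B>_def)
    then have "y \<in> A" by (auto simp: A_def y_def)
    \<comment> \<open>The rotation identity, rewritten with \<open>g ^ q - 1 = (g - 1) * m\<close>;
      cancelling \<open>g - 1\<close> turns the correction into the digit
      \<open>k * m\<close>.\<close>
    moreover have "(int g - 1) * (int g * y) = (int g - 1) * (x + k * int m)"
    proof -
      have "(int g - 1) * (int g * y) = int g * S C"
        using S[OF CB] by (metis mult.left_commute y_def)
      also have "\<dots> = S B + k * ((int g - 1) * int m)" using C(4) m' by simp
      also have "\<dots> = (int g - 1) * x + k * ((int g - 1) * int m)" using S[OF B(1)] B(2) by simp
      finally show ?thesis by (simp add: algebra_simps)
    qed
    then have "int g * y = x + k * int m" using g by simp
    moreover have "k * int m \<in> {0, int m}" using C(3) by auto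
    ultimately show ?thesis by blast
  qed
  ultimately obtain X where X: "extreme_cycle g m X" "X \<subseteq> A"
    using exists_extreme_cycle_subset[of g A m] g by (metis gr0I not_numeral_le_zero)
  then have "X \<noteq> {0}" using \<open>0 \<notin> A\<close> by auto
  then show ?thesis using X(1) unfolding incomplete_number_def complete_number_def by blast
qed

theorem theorem2p23:
  fixes g q m :: nat
  assumes "g \<ge> 4" and "even g"
    and "q > g - 1" and "coprime q (g - 1)"
    and "m = (g ^ q - 1) div (g - 1)"
  shows "incomplete_number g m \<and> ord m g = q
    \<and> (\<forall>e. e dvd m \<and> e > 1 \<longrightarrow> ord e g \<noteq> 1 \<and> ord e g dvd q)
    \<and> (prime q \<longrightarrow>
         (\<exists>d. primitive_number g d \<and> coprime d g \<and> ord d g = q)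
         \<and> (\<forall>d. primitive_number g d \<and> d dvd m \<longrightarrow> ord d g = q))"
proof -
  have g1: "g > 1" and q1: "q > 1" using assms(1,3) by auto
  have geo: "(g - 1) * (\<Sum>i<n. g ^ i) = g ^ n - 1" for n
  proof -
    have "int ((g - 1) * (\<Sum>i<n. g ^ i)) = int (g ^ n - 1)"
      using g1 power_diff_1_eq[of "int g" n] by (simp add: of_nat_diff)
    then show ?thesis by (simp only: of_nat_eq_iff)
  qed
  have msum: "m = (\<Sum>i<q. g ^ i)"
    using g1 assms(5) geo[of q] by (metis nonzero_mult_div_cancel_left zero_less_diff less_not_refl)
  have gm: "(g - 1) * m = g ^ q - 1" using geo msum by simp
  have incomplete: "incomplete_number g m"
    using incomplete_repunit[OF _ _ gm] assms(1,3) by simp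
  have cong_q: "[g ^ q = 1] (mod e)" if "e dvd m" for e
  proof -
    have "e dvd g ^ q - 1" using gm that by (metis dvd_mult)
    then show ?thesis using g1 by (simp add: cong_altdef_nat)
  qed
  have coprime: "coprime e g" if "e dvd m" for e
    using cong_q[OF that] q1
    by (metis cong_imp_coprime cong_sym coprime_1_left coprime_commute coprime_power_left_iff
        not_one_less_zero)
  have ord_dvd: "ord e g dvd q" if "e dvd m" for e
    using cong_q[OF that] ord_divides by blast
  have ord_ne_1: "ord e g \<noteq> 1" if e: "e dvd m" "e > 1" for e
  proof
    assume "ord e g = 1"
    then have g_1: "[g = 1] (mod e)" using ord_divides[of g 1 e] by simp
    then have "[(\<Sum>i<q. g ^ i) = (\<Sum>i<q. 1)] (mod e)"
      by (intro cong_sum) (metis cong_pow power_one)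
    then have "e dvd q" using e(1) msum by (simp add: cong_dvd_iff)
    moreover have "e dvd g - 1" using g_1 g1 by (simp add: cong_altdef_nat)
    \<comment> \<open>Coprimality of \<open>q\<close> and \<open>g - 1\<close> excludes the common
      divisor \<open>e > 1\<close>.\<close>
    ultimately show False using assms(4) e(2) by (metis coprime_common_divisor_nat nat_neq_iff)
  qed
  \<comment> \<open>A smaller order \<open>k\<close> would make \<open>m\<close> divide
    \<open>g ^ k - 1\<close>, but \<open>g ^ k\<close> is one of the summands of
    \<open>m\<close>.\<close>
  have "ord m g = q"
  proof (rule ccontr)
    assume "ord m g \<noteq> q"
    moreover have "ord m g dvd q" by (simp add: ord_dvd)
    \<comment> \<open>The value 0 of \<open>ord\<close> stands for the non-coprime case.\<close>
    moreover have "ord m g \<noteq> 0"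
      using coprime[of m] by (simp add: coprime_commute)
    ultimately have k: "ord m g < q" "ord m g > 0" using q1 by (auto dest: dvd_imp_le)
    define k where "k = ord m g"
    have "m dvd g ^ k - 1"
      using ord_works[of g m] g1 by (simp add: k_def cong_altdef_nat)
    moreover have "g ^ k - 1 > 0" using k g1 one_less_power[of g k] by (simp add: k_def)
    ultimately have "m \<le> g ^ k - 1" by (rule dvd_imp_le)
    moreover have "g ^ k \<le> m"
      unfolding msum using k by (intro member_le_sum) (auto simp: k_def)
    ultimately show False using \<open>g ^ k - 1 > 0\<close> by linarith
  qed
  \<comment> \<open>Completeness of 1 gives \<open>d > 1\<close>, so the order is a divisor of the
    prime \<open>q\<close> other than 1.\<close>
  moreover have ord_eq: "ord d g = q" if "prime q" "incomplete_number g d" "d dvd m" for d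
  proof -
    have "m > 0" unfolding msum using g1 q1 by (intro sum_pos) auto
    then have "d \<noteq> 0" using that by auto
    moreover have "d \<noteq> 1"
      using that(2) complete_number_1[of g] assms(1) by (auto simp: incomplete_number_def)
    ultimately have "d > 1" by linarith
    then show ?thesis
      using ord_ne_1 ord_dvd that(1,3) by (metis prime_nat_iff)
  qed
  moreover have "\<exists>d. primitive_number g d \<and> coprime d g \<and> ord d g = q" if "prime q"
  proof -
    define P where "P = (\<lambda>d. d dvd m \<and> incomplete_number g d)"
    \<comment> \<open>The least incomplete divisor of \<open>m\<close>; \<open>m\<close> itself is a
      candidate. Proper divisors of \<open>d\<close> are smaller divisors of \<open>m\<close>, hence
      complete.\<close>
    define d where "d = (LEAST d. P d)"
    have d: "d dvd m" "incomplete_number g d"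
      using LeastI[of P m] incomplete by (auto simp: d_def P_def)
    have cop: "coprime d g" by (rule coprime[OF d(1)])
    \<comment> \<open>As \<open>g\<close> is even, coprimality to \<open>g\<close> forces
      oddness.\<close>
    then have "odd d" using assms(2) by (meson coprime_common_divisor odd_one)
    moreover have "complete_number g e" if e: "e dvd d" "e \<noteq> d" for e
    proof -
      have "d \<noteq> 0" using \<open>odd d\<close> by (cases d) auto
      then have "e < d" using e by (simp add: dvd_imp_le le_neq_implies_less)
      then have "\<not> P e" unfolding d_def by (rule not_less_Least)
      then show ?thesis using e(1) d(1) by (auto simp: P_def incomplete_number_def)
    qed
    ultimately show ?thesis
      using d cop ord_eq[OF that d(2,1)] unfolding primitive_number_def by blast
  qed
  ultimately show ?thesis
    using incomplete ord_dvd ord_ne_1 unfolding primitive_number_def by blast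
qed

end
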